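(* Let $n\ge1$ and let $T,S\in\mathbf{T}_n^2$ be standard Young tableaux with at most two columns. Then $T<_D S$ (in the induced Duflo order on tableaux) if and only if $w_T<_D w_S$ (in the right weak order on words).
   Context: A standard tableau is a filling of a Young diagram with $n$ boxes by $1,\dots,n$, each used once, increasing along rows and down columns. $\mathbf{T}_n$ is the set of standard tableaux with $n$ boxes and $\mathbf{T}_n^2\subset\mathbf{T}_n$ the subset of those with at most two columns, written $T=(T_1,T_2)$ with $T_i$ the $i$-th column ($T_2$ may be empty). Right weak order: for words $w=[a_1,\dots,a_n]$ and $y$ which are arrangements of $\{1,\dots,n\}$, let $p_w(i)$ be the position of the letter $i$ in $w$. Put $w\le_D y$ iff for all $i<j$, $p_w(j)<p_w(i)$ implies $p_y(j)<p_y(i)$; $w<_D y$ means moreover $w\ne y$. Insertion: for a column $C$ and $j\notin C$, if some entry of $C$ is greater than $j$, then $j$ replaces the smallest such entry, which is bumped and inserted in the same way in the next column; otherwise $j$ is placed at the bottom of $C$ (an empty column receives $j$). $j\Rightarrow T$ is the tableau obtained by inserting $j$ into $T$ starting with the first column. For $w=[a_1,\dots,a_n]$, $T(w):=a_1\Rightarrow(a_2\Rightarrow(\cdots\Rightarrow(a_n)))$, and $\mathcal{C}_T:=\{w: T(w)=T\}$. Induced Duflo order on $\mathbf{T}_n$: $T\le_D S$ iff there is a sequence $T=P_1,\dots,P_k=S$ in $\mathbf{T}_n$ such that for each $1\le j<k$ there are $w\in\mathcal{C}_{P_j}$, $y\in\mathcal{C}_{P_{j+1}}$ with $w\le_D y$.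 $T<_D S$ means $T\le_D S$ and $T\ne S$. Deletion: let $T$ be a tableau with at most two columns and let $a$ be an entry of $T$ at a corner box (no neighbours to the right or below). If $a$ is in the first column, $T\Leftarrow a$ is $T$ with that box removed, and $a^T:=a$. If $a$ is in the second column, $T\Leftarrow a$ is obtained by deleting $a$ from the second column and replacing by $a$ the greatest entry $b$ of the first column with $b<a$; then $a^T:=b$. The word $w_T$: for $T\in\mathbf{T}_n^2$ put $T_{(n)}=T$ and, for $i=n,n-1,\dots,1$, let $z_i$ be the maximal entry of $T_{(i)}$, $a_i:=z_i^{T_{(i)}}$ and $T_{(i-1)}:=T_{(i)}\Leftarrow z_i$. Then $w_T:=[a_n,a_{n-1},\dots,a_1]$. *)

theory Defs
  imports Main "HOL-Combinatorics.Multiset_Permutations"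
begin

text \<open>
  A tableau is the list of its nonempty columns, from left to right; each column is listed from
  top to bottom. The \<open>k\<close>-th column (counted from 0) is empty for \<open>k\<close> beyond the end of the list.
\<close>

type_synonym tableau = "nat list list"

definition column :: "tableau \<Rightarrow> nat \<Rightarrow> nat list" where
  "column T k = (if k < length T then T ! k else [])"

definition entries :: "tableau \<Rightarrow> nat set" where
  "entries T = set (concat T)"

definition num_boxes :: "tableau \<Rightarrow> nat" where
  "num_boxes T = length (concat T)"

definition standard_tableaux :: "nat \<Rightarrow> tableau set" where
  "standard_tableaux n = {T.
     [] \<notin> set T \<and>
     (\<forall>k. Suc k < length T \<longrightarrow> length (T ! Suc k) \<le> length (T ! k)) \<and>
     distinct (concat T) \<and> entries T = {1..n} \<and>
     (\<forall>k < length T. sorted_wrt (<) (T ! k)) \<and>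
     (\<forall>k i. Suc k < length T \<longrightarrow> i < length (T ! Suc k) \<longrightarrow> T ! k ! i < T ! Suc k ! i)}"

definition standard_tableaux2 :: "nat \<Rightarrow> tableau set" where
  "standard_tableaux2 n = {T \<in> standard_tableaux n. length T \<le> 2}"


text \<open>
  Words are the lists in \<open>permutations_of_set {1..n}\<close>. Positions are counted from 0 instead
  of 1, which does not affect their comparison.
\<close>

definition pos :: "nat list \<Rightarrow> nat \<Rightarrow> nat" where
  "pos w i = (THE k. k < length w \<and> w ! k = i)"

definition weak_le :: "nat \<Rightarrow> nat list \<Rightarrow> nat list \<Rightarrow> bool" where
  "weak_le n w y \<longleftrightarrow>
     w \<in> permutations_of_set {1..n} \<and> y \<in> permutations_of_set {1..n} \<and>
     (\<forall>i\<in>{1..n}. \<forall>j\<in>{1..n}. i < j \<longrightarrow> pos w j < pos w i \<longrightarrow> pos y j < pos y i)"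

definition weak_less :: "nat \<Rightarrow> nat list \<Rightarrow> nat list \<Rightarrow> bool" where
  "weak_less n w y \<longleftrightarrow> weak_le n w y \<and> w \<noteq> y"


definition replace :: "nat \<Rightarrow> nat \<Rightarrow> nat list \<Rightarrow> nat list" where
  "replace a b C = map (\<lambda>c. if c = a then b else c) C"

fun insert_col :: "nat \<Rightarrow> tableau \<Rightarrow> tableau" where
  "insert_col j [] = [[j]]"
| "insert_col j (C # T) =
     (if \<exists>c\<in>set C. j < c
      then let m = Min {c \<in> set C. j < c} in replace m j C # insert_col m T
      else (C @ [j]) # T)"

text \<open>The last letter of the word is inserted first.\<close>

definition tableau_of_word :: "nat list \<Rightarrow> tableau" where
  "tableau_of_word w = foldr insert_col w []"

definition cell :: "nat \<Rightarrow> tableau \<Rightarrow> nat list set" where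
  "cell n T = {w \<in> permutations_of_set {1..n}. tableau_of_word w = T}"

definition duflo_step :: "nat \<Rightarrow> tableau \<Rightarrow> tableau \<Rightarrow> bool" where
  "duflo_step n P Q \<longleftrightarrow>
     P \<in> standard_tableaux n \<and> Q \<in> standard_tableaux n \<and>
     (\<exists>w\<in>cell n P. \<exists>y\<in>cell n Q. weak_le n w y)"

definition duflo_le :: "nat \<Rightarrow> tableau \<Rightarrow> tableau \<Rightarrow> bool" where
  "duflo_le n T S \<longleftrightarrow>
     T \<in> standard_tableaux n \<and> S \<in> standard_tableaux n \<and> (duflo_step n)\<^sup>*\<^sup>* T S"

definition duflo_less :: "nat \<Rightarrow> tableau \<Rightarrow> tableau \<Rightarrow> bool" where
  "duflo_less n T S \<longleftrightarrow> duflo_le n T S \<and> T \<noteq> S"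


text \<open>
  Deletion from a tableau with at most two columns, meaningful only if \<open>a\<close> is the entry of a
  corner box: \<open>deletion T a\<close> is the remaining tableau \<open>T \<Leftarrow> a\<close> and \<open>expelled T a\<close> is the
  letter \<open>a\<^sup>T\<close>. The tableaux that arise have distinct entries, but their entries need not form
  an initial segment of the positive integers.
\<close>

definition two_columns :: "nat list \<Rightarrow> nat list \<Rightarrow> tableau" where
  "two_columns A B = filter (\<lambda>C. C \<noteq> []) [A, B]"

definition expelled :: "tableau \<Rightarrow> nat \<Rightarrow> nat" where
  "expelled T a =
     (if a \<in> set (column T 0) then a else Max {b \<in> set (column T 0). b < a})"

definition deletion :: "tableau \<Rightarrow> nat \<Rightarrow> tableau" where
  "deletion T a =
     (if a \<in> set (column T 0)
      then two_columns (removeAll a (column T 0)) (column T 1)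
      else two_columns (replace (expelled T a) a (column T 0)) (removeAll a (column T 1)))"

text \<open>The maximal entry of a tableau always lies in a corner box.\<close>

fun deletion_word :: "nat \<Rightarrow> tableau \<Rightarrow> nat list" where
  "deletion_word 0 T = []"
| "deletion_word (Suc i) T =
     (let z = Max (entries T) in expelled T z # deletion_word i (deletion T z))"

definition word_of_tableau :: "tableau \<Rightarrow> nat list" where
  "word_of_tableau T = deletion_word (num_boxes T) T"

end

theory Submission
  imports Defs
begin

text \<open>
  The right weak order is reverse inclusion of the sets of non-inversions, and a word whose tableau
  has at most two columns avoids the pattern 123. A word that avoids 123 and has no consecutive
  pattern 132 or 213 is the word \<open>w\<^sub>T\<close> of its tableau: it is cut into single letters and ascending
  pairs, and the tableau is read off the blocks. Replacing a consecutive 132 by 312 or 213 by 231 is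
  a Knuth move, hence keeps the tableau; it goes up in the weak order and, as another 123 would
  arise otherwise, never leaves the set of words below a given \<open>w\<^sub>S\<close>. So \<open>w \<le>\<^sub>D y\<close> first gives
  \<open>w \<le>\<^sub>D w\<^sub>S\<close> and then \<open>w\<^sub>T \<le>\<^sub>D w\<^sub>S\<close>, where \<open>T\<close> and \<open>S\<close> are the tableaux of \<open>w\<close> and \<open>y\<close>.
\<close>

section \<open>Non-inversions\<close>

fun noninv :: "nat list \<Rightarrow> (nat \<times> nat) set" where
  "noninv [] = {}"
| "noninv (x # w) = {(x, j) | j. j \<in> set w \<and> x < j} \<union> noninv w"

lemma noninv_subset: "noninv w \<subseteq> set w \<times> set w"
  by (induction w) auto

lemma noninv_less: "(i, j) \<in> noninv w \<Longrightarrow> i < j"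
  by (induction w) auto

lemma finite_noninv: "finite (noninv w)"
  using finite_subset[OF noninv_subset] by blast

lemma noninv_append:
  "noninv (u @ v) = noninv u \<union> noninv v \<union> {(i, j). i \<in> set u \<and> j \<in> set v \<and> i < j}"
  by (induction u) auto

text \<open>Only the relative order of the two neighbours changes, so swapping an adjacent ascent
  removes a single pair: a cover in the weak order.\<close>

lemma noninv_swap:
  "a < b \<Longrightarrow> noninv (p @ a # b # q) = insert (a, b) (noninv (p @ b # a # q))"
  by (auto simp: noninv_append)

lemma noninv_antisym:
  assumes "distinct (p @ b # q)" "a \<in> set q"
  shows "(a, b) \<notin> noninv (p @ b # q)"
  using assms noninv_subset[of p] noninv_subset[of q] by (auto simp: noninv_append)

lemma noninv_iff_nth:
  "(i, j) \<in> noninv w \<longleftrightarrow> i < j \<and> (\<exists>k l. k < l \<and> l < length w \<and> w ! k = i \<and> w ! l = j)"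
proof (induction w)
  case (Cons x w)
  have "(\<exists>k l. k < l \<and> l < length (x # w) \<and> (x # w) ! k = i \<and> (x # w) ! l = j) \<longleftrightarrow>
      (x = i \<and> j \<in> set w) \<or> (\<exists>k l. k < l \<and> l < length w \<and> w ! k = i \<and> w ! l = j)" (is "?l \<longleftrightarrow> ?r")
  proof
    assume ?l
    then obtain k l where "k < l" "l < length (x # w)" "(x # w) ! k = i" "(x # w) ! l = j" by blast
    then show ?r by (cases k; cases l) auto
  next
    assume ?r
    then show ?l
    proof
      assume "x = i \<and> j \<in> set w"
      then obtain l where "x = i" "l < length w" "w ! l = j" by (auto simp: in_set_conv_nth)
      then show ?l by (intro exI[of _ 0] exI[of _ "Suc l"]) auto
    next
      assume "\<exists>k l. k < l \<and> l < length w \<and> w ! k = i \<and> w ! l = j"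
      then obtain k l where "k < l" "l < length w" "w ! k = i" "w ! l = j" by blast
      then show ?l by (intro exI[of _ "Suc k"] exI[of _ "Suc l"]) auto
    qed
  qed
  then show ?case using Cons.IH by auto
qed simp

section \<open>Translating the weak order into non-inversions\<close>

lemma pos_nth: "distinct w \<Longrightarrow> k < length w \<Longrightarrow> pos w (w ! k) = k"
  unfolding pos_def by (rule the_equality) (auto simp: nth_eq_iff_index_eq)

lemma noninv_iff_pos:
  assumes "distinct w" "i \<in> set w" "j \<in> set w" "i < j"
  shows "(i, j) \<in> noninv w \<longleftrightarrow> \<not> pos w j < pos w i"
proof -
  obtain k l where kl: "k < length w" "w ! k = i" "l < length w" "w ! l = j"
    using assms by (auto simp: in_set_conv_nth)
  then have "pos w i = k" "pos w j = l" "k \<noteq> l"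
    using assms pos_nth by auto
  moreover have "(i, j) \<in> noninv w \<longleftrightarrow> k < l"
    using kl assms by (auto simp: noninv_iff_nth nth_eq_iff_index_eq)
  ultimately show ?thesis by auto
qed

text \<open>Contraposing the condition on positions, pair by pair, turns the preservation of
  inversions into the inclusion of non-inversions in the opposite direction.\<close>

lemma weak_le_iff:
  "weak_le n w y \<longleftrightarrow> distinct w \<and> distinct y \<and> set w = {1..n} \<and> set y = {1..n} \<and>
     noninv y \<subseteq> noninv w"
proof (cases "distinct w \<and> distinct y \<and> set w = {1..n} \<and> set y = {1..n}")
  case True
  then have w: "distinct w" "set w = {1..n}" and y: "distinct y" "set y = {1..n}" by auto
  have "(pos w j < pos w i \<longrightarrow> pos y j < pos y i) \<longleftrightarrow> ((i, j) \<in> noninv y \<longrightarrow> (i, j) \<in> noninv w)"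
    if "i \<in> {1..n}" "j \<in> {1..n}" "i < j" for i j
    using noninv_iff_pos[of w i j] noninv_iff_pos[of y i j] that w y by blast
  then have "(\<forall>i\<in>{1..n}. \<forall>j\<in>{1..n}. i < j \<longrightarrow> pos w j < pos w i \<longrightarrow> pos y j < pos y i) \<longleftrightarrow>
      (\<forall>i\<in>{1..n}. \<forall>j\<in>{1..n}. i < j \<longrightarrow> (i, j) \<in> noninv y \<longrightarrow> (i, j) \<in> noninv w)"
    by blast
  also have "\<dots> \<longleftrightarrow> noninv y \<subseteq> noninv w"
  proof -
    have "i \<in> {1..n} \<and> j \<in> {1..n} \<and> i < j" if "(i, j) \<in> noninv y" for i j
      using noninv_subset[of y] noninv_less[OF that] that y(2) by blast
    then show ?thesis by fast
  qed
  finally show ?thesis using w y by (simp add: weak_le_def permutations_of_set_def)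
qed (auto simp: weak_le_def permutations_of_set_def)

text \<open>For words without repetitions, two composable non-inversions are an occurrence of 123.
  In this form avoidance passes to subsets of \<open>noninv\<close>, that is, up the weak
  order.\<close>

definition avoids123 :: "nat list \<Rightarrow> bool" where
  "avoids123 w \<longleftrightarrow> (\<forall>i j k. (i, j) \<in> noninv w \<longrightarrow> (j, k) \<notin> noninv w)"

lemma avoids123_mono: "avoids123 w \<Longrightarrow> noninv y \<subseteq> noninv w \<Longrightarrow> avoids123 y"
  unfolding avoids123_def by blast


section \<open>Knuth invariance of column insertion\<close>

text \<open>Insertion into one column is split into the letter passed on (\<open>bump\<close>) and
  the column left behind (\<open>settle\<close>), so that the Knuth relations can be checked column
  by column.\<close>

definition bump :: "nat \<Rightarrow> nat list \<Rightarrow> nat option" where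
  "bump x C = (if \<exists>c\<in>set C. x < c then Some (Min {c \<in> set C. x < c}) else None)"

definition settle :: "nat \<Rightarrow> nat list \<Rightarrow> nat list" where
  "settle x C = (case bump x C of None \<Rightarrow> C @ [x] | Some m \<Rightarrow> replace m x C)"

definition insert_opt :: "nat option \<Rightarrow> tableau \<Rightarrow> tableau" where
  "insert_opt z T = (case z of None \<Rightarrow> T | Some m \<Rightarrow> insert_col m T)"

lemma insert_opt_simps [simp]:
  "insert_opt None T = T" "insert_opt (Some m) T = insert_col m T"
  by (auto simp: insert_opt_def)

lemma insert_col_Cons: "insert_col x (C # T) = settle x C # insert_opt (bump x C) T"
  by (auto simp: bump_def settle_def insert_opt_def Let_def)

declare insert_col.simps(2) [simp del]

lemma bump_None_iff: "bump x C = None \<longleftrightarrow> (\<forall>c\<in>set C. c \<le> x)"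
proof -
  have "(\<forall>c\<in>set C. c \<le> x) \<longleftrightarrow> \<not> (\<exists>c\<in>set C. x < c)" by (meson not_le)
  then show ?thesis by (simp add: bump_def)
qed

lemma bump_Some_iff:
  "bump x C = Some m \<longleftrightarrow> m \<in> set C \<and> x < m \<and> (\<forall>d\<in>set C. x < d \<longrightarrow> m \<le> d)"
proof (cases "\<exists>c\<in>set C. x < c")
  case True
  then have "Min {c \<in> set C. x < c} = m \<longleftrightarrow>
      m \<in> {c \<in> set C. x < c} \<and> (\<forall>d\<in>{c \<in> set C. x < c}. m \<le> d)"
    by (intro Min_eq_iff) auto
  with True show ?thesis by (simp add: bump_def) blast
next
  case False
  then show ?thesis by (simp add: bump_def)
qed

lemma bump_eqI:
  assumes "\<And>m. m \<in> set C \<and> x < m \<and> (\<forall>d\<in>set C. x < d \<longrightarrow> m \<le> d) \<longleftrightarrow>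
    m \<in> set D \<and> y < m \<and> (\<forall>d\<in>set D. y < d \<longrightarrow> m \<le> d)"
  shows "bump x C = bump y D"
proof -
  have "bump x C = Some m \<longleftrightarrow> bump y D = Some m" for m
    unfolding bump_Some_iff by (rule assms)
  then show ?thesis by (cases "bump x C") (metis not_Some_eq)+
qed

lemma set_settle:
  "set (settle x C) = insert x (case bump x C of None \<Rightarrow> set C | Some m \<Rightarrow> set C - {m})"
proof (cases "bump x C")
  case (Some m)
  then have "m \<in> set C" by (simp add: bump_Some_iff)
  with Some show ?thesis by (auto simp: settle_def replace_def)
qed (simp add: settle_def)

lemma sorted_settle:
  assumes "sorted_wrt (<) C" "x \<notin> set C"
  shows "sorted_wrt (<) (settle x C)"
proof (cases "bump x C")
  case None
  then have "\<forall>c\<in>set C. c < x" using assms(2) by (auto simp: bump_None_iff le_less)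
  with None assms show ?thesis by (simp add: settle_def sorted_wrt_append)
next
  case (Some m)
  then have m: "m \<in> set C" "x < m" "\<And>d. d \<in> set C \<Longrightarrow> x < d \<Longrightarrow> m \<le> d"
    by (auto simp: bump_Some_iff)
  have "sorted_wrt (\<lambda>c d. (if c = m then x else c) < (if d = m then x else d)) C"
    using assms(1)
  proof (rule sorted_wrt_mono_rel[rotated])
    fix c d assume "c \<in> set C" "d \<in> set C" "c < d"
    then show "(if c = m then x else c) < (if d = m then x else d)"
      using m(1,2) m(3)[of c] assms(2) by (cases c x rule: linorder_cases) auto
  qed
  with Some show ?thesis by (simp add: settle_def replace_def sorted_wrt_map)
qed

text \<open>The entry \<open>e\<close> separates the two insertions: \<open>a\<close> bumps a letter
  that is at most \<open>e\<close>, while \<open>c\<close> bumps only above \<open>c\<close> or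
  nothing at all.\<close>

lemma settle_insert_commute:
  assumes "sorted_wrt (<) D" "e \<in> set D" "a < e" "e < c" "a \<notin> set D" "c \<notin> set D"
  shows "bump a (settle c D) = bump a D" "bump c (settle a D) = bump c D"
    "settle a (settle c D) = settle c (settle a D)"
proof -
  obtain m where m: "bump a D = Some m" "m \<in> set D" "a < m" "m \<le> e" "\<forall>d\<in>set D. a < d \<longrightarrow> m \<le> d"
    using assms by (cases "bump a D") (auto simp: bump_None_iff bump_Some_iff)
  have c: "bump c D = Some m' \<Longrightarrow> m' \<in> set D \<and> c < m' \<and> (\<forall>d\<in>set D. c < d \<longrightarrow> m' \<le> d)" for m'
    by (simp add: bump_Some_iff)
  have a1: "bump a (settle c D) = Some m"
    unfolding bump_Some_iff set_settle using m assms c by (fastforce split: option.splits)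
  show 1: "bump a (settle c D) = bump a D" using a1 m by simp
  show 2: "bump c (settle a D) = bump c D"
    by (rule bump_eqI) (use m assms in \<open>auto simp: set_settle\<close>)
  \<comment> \<open>Strictly increasing lists with equal sets are equal, so the columns are compared
    as sets.\<close>
  have "set (settle a (settle c D)) = set (settle c (settle a D))"
    unfolding set_settle[of a "settle c D"] set_settle[of c "settle a D"] 1 2
    using m assms c by (fastforce simp: set_settle split: option.splits)
  moreover have "sorted_wrt (<) (settle a (settle c D))" "sorted_wrt (<) (settle c (settle a D))"
    using assms by (auto intro!: sorted_settle simp: set_settle split: option.splits)
  ultimately show "settle a (settle c D) = settle c (settle a D)"
    by (simp add: strict_sorted_equal)
qed

text \<open>No entry lies in the interval from \<open>a\<close> to \<open>c\<close>, so both letters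
  see the same larger entries. Once \<open>c\<close> has entered it is the smallest entry above
  \<open>a\<close>, and \<open>a\<close> takes its place.\<close>

lemma settle_gap:
  assumes "sorted_wrt (<) D" "a < c" "\<And>d. d \<in> set D \<Longrightarrow> d < a \<or> c < d"
  shows "bump a D = bump c D" "bump a (settle c D) = Some c" "settle a (settle c D) = settle a D"
proof -
  have gap: "a < d \<longleftrightarrow> c < d" "d \<noteq> a" "d \<noteq> c" if "d \<in> set D" for d
    using assms(2) assms(3)[OF that] by auto
  show 1: "bump a D = bump c D"
    by (rule bump_eqI) (use gap in blast)
  show 2: "bump a (settle c D) = Some c"
    unfolding bump_Some_iff set_settle using assms(2) gap
    by (auto split: option.splits)
  have "set (settle a (settle c D)) = set (settle a D)"
    unfolding set_settle[of a "settle c D"] set_settle[of a D] 2 1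
    using gap assms(2) by (auto simp: set_settle bump_Some_iff split: option.splits)
  moreover have "sorted_wrt (<) (settle c D)" "sorted_wrt (<) (settle a D)"
    using sorted_settle[OF assms(1)] gap by blast+
  moreover have "a \<notin> set (settle c D)"
    using gap assms(2) by (auto simp: set_settle split: option.splits)
  ultimately show "settle a (settle c D) = settle a D"
    by (simp add: strict_sorted_equal sorted_settle)
qed

section \<open>Knuth relations on tableaux with distinct letters and increasing columns\<close>

definition columns_ok :: "tableau \<Rightarrow> bool" where
  "columns_ok T \<longleftrightarrow> distinct (concat T) \<and> (\<forall>C\<in>set T. sorted_wrt (<) C)"

lemma columns_ok_Cons:
  "columns_ok (C # T) \<longleftrightarrow> sorted_wrt (<) C \<and> columns_ok T \<and> set C \<inter> set (concat T) = {}"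
  by (auto simp: columns_ok_def strict_sorted_iff)

lemma set_insert_col: "columns_ok T \<Longrightarrow> set (concat (insert_col x T)) = insert x (set (concat T))"
proof (induction T arbitrary: x)
  case (Cons C T)
  show ?case
  proof (cases "bump x C")
    case None
    then show ?thesis by (simp add: insert_col_Cons set_settle)
  next
    case (Some m)
    then have "m \<in> set C" by (simp add: bump_Some_iff)
    then show ?thesis using Some Cons
      by (auto simp: insert_col_Cons set_settle columns_ok_Cons simp del: set_concat)
  qed
qed simp

lemma columns_ok_insert_col:
  "columns_ok T \<Longrightarrow> x \<notin> set (concat T) \<Longrightarrow> columns_ok (insert_col x T)"
proof (induction T arbitrary: x)
  case (Cons C T)
  then have C: "sorted_wrt (<) C" "columns_ok T" "set C \<inter> set (concat T) = {}"
    "x \<notin> set C" "x \<notin> set (concat T)"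
    by (auto simp: columns_ok_Cons)
  show ?case
  proof (cases "bump x C")
    case None
    then show ?thesis using C
      by (auto simp: insert_col_Cons columns_ok_Cons set_settle sorted_settle)
  next
    case (Some m)
    then have m: "m \<in> set C" by (simp add: bump_Some_iff)
    with C have "columns_ok (insert_col m T)" by (intro Cons.IH) auto
    then show ?thesis using C Some m set_insert_col[OF C(2), of m]
      by (auto simp: insert_col_Cons columns_ok_Cons set_settle sorted_settle simp del: set_concat)
  qed
qed (simp add: columns_ok_def)

lemma knuth_insert_Nil:
  assumes "a < b" "b < c"
  shows "insert_col a (insert_col c (insert_col b [])) = insert_col c (insert_col a (insert_col b []))"
    and "insert_col b (insert_col a (insert_col c [])) = insert_col b (insert_col c (insert_col a []))"
proof -
  \<comment> \<open>These are the candidate sets whose minima are bumped.\<close>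
  have [simp]: "{x. (x = b \<or> x = c) \<and> a < x} = {b, c}" "{x. x = c \<and> b < x} = {c}"
    "{x. x = b \<and> a < x} = {b}" "{x. x = c \<and> a < x} = {c}" "{x. (x = a \<or> x = c) \<and> b < x} = {c}"
    using assms by auto
  show "insert_col a (insert_col c (insert_col b [])) = insert_col c (insert_col a (insert_col b []))"
    "insert_col b (insert_col a (insert_col c [])) = insert_col b (insert_col c (insert_col a []))"
    using assms by (auto simp: insert_col.simps(2) replace_def Let_def)
qed

text \<open>The letters bumped out of a column by the two sides of a Knuth relation are equal or again
  the two sides of a Knuth relation. If the column has no entry between \<open>a\<close> and \<open>c\<close>, the second
  relation is turned into the first one.\<close>

lemma knuth_insert:
  assumes "columns_ok T" "a < b" "b < c" "{a, b, c} \<inter> set (concat T) = {}"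
  shows "insert_col a (insert_col c (insert_col b T)) = insert_col c (insert_col a (insert_col b T))
    \<and> insert_col b (insert_col a (insert_col c T)) = insert_col b (insert_col c (insert_col a T))"
  using assms
proof (induction T arbitrary: a b c)
  case Nil
  show ?case using knuth_insert_Nil[OF Nil.prems(2,3)] by (rule conjI)
next
  case (Cons C T)
  then have C: "sorted_wrt (<) C" "columns_ok T" "set C \<inter> set (concat T) = {}"
    "a \<notin> set C" "b \<notin> set C" "c \<notin> set C"
    by (auto simp: columns_ok_Cons)
  have IH: "insert_col x (insert_col z (insert_col y T)) = insert_col z (insert_col x (insert_col y T))"
      "insert_col y (insert_col x (insert_col z T)) = insert_col y (insert_col z (insert_col x T))"
    if "x < y" "y < z" "{x, y, z} \<inter> set (concat T) = {}" for x y z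
    by (rule Cons.IH[OF C(2) that, THEN conjunct1], rule Cons.IH[OF C(2) that, THEN conjunct2])
  have 1: "insert_col a (insert_col c (insert_col b (C # T))) =
    insert_col c (insert_col a (insert_col b (C # T)))"
  proof -
    \<comment> \<open>Once \<open>b\<close> has entered, it separates \<open>a\<close> from
      \<open>c\<close> in the column, so these two commute there and only the letters passed on
      remain to be compared.\<close>
    define D where "D = settle b C"
    have D: "sorted_wrt (<) D" "b \<in> set D" "a \<notin> set D" "c \<notin> set D"
      using C Cons.prems by (auto simp: D_def sorted_settle set_settle split: option.splits)
    note comm = settle_insert_commute[OF D(1,2) Cons.prems(2,3) D(3,4)]
    obtain x where x: "bump a D = Some x" "x \<le> b" "x \<in> set D"
      using D Cons.prems by (cases "bump a D") (auto simp: bump_None_iff bump_Some_iff)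
    have "insert_col x (insert_opt (bump c D) (insert_opt (bump b C) T)) =
      insert_opt (bump c D) (insert_col x (insert_opt (bump b C) T))"
    \<comment> \<open>If \<open>c\<close> bumps some \<open>z\<close>, the letters \<open>x\<close>,
      \<open>y\<close>, \<open>z\<close> bumped by \<open>a\<close>, \<open>b\<close>,
      \<open>c\<close> satisfy \<open>x < y < z\<close>, and the first relation recurs in the next
      column.\<close>
    proof (cases "bump c D")
      case (Some z)
      then have z: "z \<in> set D" "c < z" by (auto simp: bump_Some_iff)
      then have "z \<in> set C" using Cons.prems by (auto simp: D_def set_settle split: option.splits)
      with z Cons.prems(3) obtain y where y: "bump b C = Some y" "y \<in> set C" "b < y" "y \<le> z"
        by (cases "bump b C") (auto simp: bump_None_iff bump_Some_iff)
      with z have "y \<noteq> z" using Cons.prems(3) by (auto simp: D_def set_settle)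
      moreover have "{x, y, z} \<inter> set (concat T) = {}"
        using x y \<open>z \<in> set C\<close> C(3) Cons.prems(4)
        by (auto simp: D_def set_settle split: option.splits)
      ultimately show ?thesis using IH(1)[of x y z] Some x y by simp
    qed simp
    then show ?thesis using comm x by (simp add: insert_col_Cons D_def)
  qed
  have 2: "insert_col b (insert_col a (insert_col c (C # T))) =
    insert_col b (insert_col c (insert_col a (C # T)))"
  proof (cases "\<exists>e\<in>set C. a < e \<and> e < c")
    case True
    then obtain e where e: "e \<in> set C" "a < e" "e < c" by blast
    note comm = settle_insert_commute[OF C(1) e C(4,6)]
    obtain x where x: "bump a C = Some x" "x \<le> e" "x \<in> set C" "\<forall>d\<in>set C. a < d \<longrightarrow> x \<le> d"
      using e by (cases "bump a C") (auto simp: bump_None_iff bump_Some_iff)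
    \<comment> \<open>Both orders of \<open>a\<close> and \<open>c\<close> leave the same column
      \<open>E\<close>. It still contains \<open>c\<close>, so \<open>b\<close> bumps some
      \<open>y\<close> that is at most \<open>c\<close>, and the bumped letters
      \<open>x < y < z\<close> repeat the second relation.\<close>
    define E where "E = settle a (settle c C)"
    have "c \<in> set (settle c C)" by (simp add: set_settle)
    then have cE: "c \<in> set E" using comm(1) x e by (auto simp: E_def set_settle[of a])
    then obtain y where y: "bump b E = Some y" "y \<le> c" "b < y" "y \<in> set E"
      using Cons.prems by (cases "bump b E") (auto simp: bump_None_iff bump_Some_iff)
    have "x \<notin> set E" using comm(1) x e C(4) by (auto simp: E_def set_settle[of a])
    have y': "y = c \<or> y \<in> set C"
      using y Cons.prems unfolding E_def by (auto simp: set_settle split: option.splits)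
    have "x \<noteq> y" using y \<open>x \<notin> set E\<close> by blast
    moreover have "x \<le> y" using y'
    proof
      assume "y = c"
      then show ?thesis using x(2) e(3) by simp
    next
      assume "y \<in> set C"
      then show ?thesis using x(4) y(3) Cons.prems(2) by simp
    qed
    ultimately have "x < y" by simp
    have "insert_col y (insert_col x (insert_opt (bump c C) T)) =
      insert_col y (insert_opt (bump c C) (insert_col x T))"
    proof (cases "bump c C")
      case (Some z)
      then have z: "z \<in> set C" "c < z" by (auto simp: bump_Some_iff)
      moreover have "{x, y, z} \<inter> set (concat T) = {}"
        using x y' z C(3) Cons.prems(4) by auto
      ultimately show ?thesis using IH(2)[of x y z] Some \<open>x < y\<close> y by simp
    qed simp
    then show ?thesis using comm x y by (simp add: insert_col_Cons E_def)
  next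
    case False
    then have gap: "d < a \<or> c < d" if "d \<in> set C" for d
      using that C(4,6) by (cases "d = a"; cases "d = c") auto
    define D where "D = settle a C"
    have D: "sorted_wrt (<) D" using C by (simp add: D_def sorted_settle)
    have gapD: "d < b \<or> c < d" if "d \<in> set D" for d
      using that gap Cons.prems unfolding D_def by (force simp: set_settle split: option.splits)
    have "a < c" using Cons.prems by simp
    note g1 = settle_gap[OF C(1) \<open>a < c\<close> gap]
    note g2 = settle_gap[OF D Cons.prems(3) gapD]
    \<comment> \<open>Let \<open>y\<close> be bumped from \<open>C\<close> by \<open>c\<close>
      (equally by \<open>a\<close>) and \<open>z\<close> from \<open>D\<close> by \<open>b\<close>.
      One side passes on \<open>y\<close>, \<open>c\<close>, \<open>z\<close>, the other
      \<open>y\<close>, \<open>z\<close>, \<open>c\<close>; as \<open>c < y < z\<close>, this is the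
      first relation.\<close>
    have "insert_opt (bump b D) (insert_col c (insert_opt (bump c C) T)) =
       insert_col c (insert_opt (bump b D) (insert_opt (bump c C) T))"
    proof (cases "bump b D")
      case (Some z)
      then have z: "z \<in> set D" "b < z" by (auto simp: bump_Some_iff)
      then have zC: "z \<in> set C" "c < z" using gapD[of z] Cons.prems
        by (auto simp: D_def set_settle split: option.splits)
      then obtain y where y: "bump c C = Some y" "c < y" "y \<le> z" "y \<in> set C"
        by (cases "bump c C") (auto simp: bump_None_iff bump_Some_iff)
      have "y \<noteq> z" using z y g1(1) Cons.prems by (auto simp: D_def set_settle)
      moreover have "{c, y, z} \<inter> set (concat T) = {}" using y zC C(3) Cons.prems(4) by auto
      ultimately show ?thesis using IH(1)[of c y z] Some y by simp
    qed simp
    then show ?thesis using g1 g2 by (simp add: insert_col_Cons D_def)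
  qed
  from 1 2 show ?case by (rule conjI)
qed

section \<open>Knuth moves inside words\<close>

lemma tableau_of_word_append:
  "tableau_of_word (p @ q) = foldr insert_col p (tableau_of_word q)"
  by (simp add: tableau_of_word_def)

lemma tableau_of_word_Cons [simp]:
  "tableau_of_word [] = []" "tableau_of_word (x # w) = insert_col x (tableau_of_word w)"
  by (simp_all add: tableau_of_word_def)

lemma tableau_of_word_ok:
  "distinct w \<Longrightarrow> columns_ok (tableau_of_word w) \<and> set (concat (tableau_of_word w)) = set w"
  by (induction w)
    (auto simp: columns_ok_insert_col set_insert_col simp del: set_concat, simp_all add: columns_ok_def)

text \<open>The suffix \<open>q\<close> is inserted first, so the relation is applied to its
  tableau; inserting \<open>p\<close> afterwards keeps the equality.\<close>

lemma knuth_tableau_of_word: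
  assumes "a < b" "b < c"
  shows "distinct (p @ a # c # b # q) \<Longrightarrow>
      tableau_of_word (p @ a # c # b # q) = tableau_of_word (p @ c # a # b # q)"
    and "distinct (p @ b # a # c # q) \<Longrightarrow>
      tableau_of_word (p @ b # a # c # q) = tableau_of_word (p @ b # c # a # q)"
  using knuth_insert[OF _ assms, of "tableau_of_word q"] tableau_of_word_ok[of q]
  by (auto simp: tableau_of_word_append simp del: set_concat)


section \<open>At most two columns\<close>

text \<open>Columns never disappear, so every suffix of a word with a two-column tableau again has
  at most two columns. This feeds the induction below.\<close>

lemma length_insert_col: "length T \<le> length (insert_col x T)"
proof (induction T arbitrary: x)
  case (Cons C T)
  then show ?case by (cases "bump x C") (auto simp: insert_col_Cons)
qed simp

text \<open>Nothing is ever bumped out of the second column, so that a letter bumped into it exceeds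
  all its entries. The invariant then excludes a third letter.\<close>

lemma two_columns_invariant:
  assumes "distinct w" "length (tableau_of_word w) \<le> 2"
  shows "avoids123 w \<and> (\<forall>(j, k) \<in> noninv w. j \<in> set (column (tableau_of_word w) 0) \<and>
    (\<exists>y\<in>set (column (tableau_of_word w) 1). j < y \<and> y \<le> k))"
  using assms
proof (induction w)
  case Nil
  then show ?case by (simp add: avoids123_def)
next
  case (Cons x w)
  define T where "T = tableau_of_word w"
  have len: "length (insert_col x T) \<le> 2" "length T \<le> 2"
    using Cons.prems length_insert_col[of T x] by (auto simp: T_def)
  have IH: "avoids123 w" "\<And>j k. (j, k) \<in> noninv w \<Longrightarrow> j \<in> set (column T 0)"
    "\<And>j k. (j, k) \<in> noninv w \<Longrightarrow> \<exists>y\<in>set (column T 1). j < y \<and> y \<le> k"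
    using Cons len by (auto simp: T_def)
  have sT: "set (concat T) = set w"
    using Cons.prems tableau_of_word_ok[of w] by (simp add: T_def)
  show ?case
  proof (cases T)
    case Nil
    then have "w = []" using sT by simp
    then show ?thesis by (simp add: avoids123_def)
  next
    case (Cons A R)
    define B where "B = column T 1"
    have AB: "column T 0 = A" "R = [] \<and> B = [] \<or> R = [B]" "set w = set A \<union> set B"
      using Cons len(2) sT by (cases R; auto simp: B_def column_def)+
    show ?thesis
    proof (cases "bump x A")
      case None
      then have c: "column (insert_col x T) 0 = A @ [x]" "column (insert_col x T) 1 = B"
        using Cons AB by (auto simp: insert_col_Cons settle_def column_def)
      \<comment> \<open>All of \<open>A\<close> is at most \<open>x\<close>, so letters above
        \<open>x\<close> lie in \<open>B\<close> only; by the invariant they start no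
        non-inversion.\<close>
      have B: "k \<in> set B" if "k \<in> set w" "x < k" for k
        using None that AB by (auto simp: bump_None_iff)
      have no: "(j, k) \<notin> noninv w" if "x < j" for j k
        using None that IH(2)[of j k] unfolding AB(1) bump_None_iff by (meson not_le)
      have "avoids123 (x # w)"
        unfolding avoids123_def
      proof (intro allI impI notI)
        fix i j k assume ij: "(i, j) \<in> noninv (x # w)" and jk: "(j, k) \<in> noninv (x # w)"
        have "j \<in> set w" using ij noninv_subset[of w] by auto
        then have "(j, k) \<in> noninv w" using jk Cons.prems(1) by auto
        moreover from this have "(i, j) \<in> noninv w" using ij no by auto
        ultimately show False using IH(1) by (auto simp: avoids123_def)
      qed
      moreover have "j \<in> set (A @ [x]) \<and> (\<exists>y\<in>set B. j < y \<and> y \<le> k)"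
        if "(j, k) \<in> noninv (x # w)" for j k
      proof (cases "(j, k) \<in> noninv w")
        case True
        then show ?thesis using IH(2,3)[OF True] AB by (simp add: B_def)
      next
        case False
        then have "j = x" "k \<in> set w" "x < k" using that by auto
        then show ?thesis using B by auto
      qed
      ultimately show ?thesis using c by (auto simp: T_def)
    next
      case (Some m)
      then have m: "m \<in> set A" "x < m" "\<And>d. d \<in> set A \<Longrightarrow> x < d \<Longrightarrow> m \<le> d"
        by (auto simp: bump_Some_iff)
      \<comment> \<open>Otherwise \<open>m\<close> would bump an entry of \<open>B\<close> into a
        third column.\<close>
      have top: "\<forall>y\<in>set B. y \<le> m"
      proof (cases "bump m B")
        case (Some y)
        then have "R = [B]" using AB by (auto simp: bump_def)
        then have "length (insert_col x T) = 3"
          using Some \<open>bump x A = Some m\<close> Cons by (simp add: insert_col_Cons)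
        then show ?thesis using len by simp
      qed (simp add: bump_None_iff)
      then have "bump m B = None" by (simp add: bump_None_iff)
      then have c0: "set (column (insert_col x T) 0) = insert x (set A - {m})"
         "set (column (insert_col x T) 1) = insert m (set B)"
        using Some Cons AB by (auto simp: insert_col_Cons column_def set_settle)
      \<comment> \<open>A non-inversion starting at \<open>j\<close> needs an entry of
        \<open>B\<close> above \<open>j\<close>, but none exceeds \<open>m\<close>. A letter of
        \<open>A\<close> above \<open>x\<close> is at least \<open>m\<close>, so no 123 can begin
        with \<open>x\<close>.\<close>
      have no: "(j, k) \<notin> noninv w" if "m \<le> j" for j k
        using IH(3)[of j k] top that by (fastforce simp: B_def)
      have "avoids123 (x # w)"
        unfolding avoids123_def
      proof (intro allI impI notI)
        fix i j k assume ij: "(i, j) \<in> noninv (x # w)" and jk: "(j, k) \<in> noninv (x # w)"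
        show False
        proof (cases "(i, j) \<in> noninv w")
          case True
          then have "j \<noteq> x" using noninv_subset[of w] Cons.prems by auto
          with jk True IH(1) show False by (auto simp: avoids123_def)
        next
          case False
          then have "i = x" "x < j" using ij by auto
          then have "(j, k) \<in> noninv w" using jk by auto
          then show False using IH(2)[of j k] AB m(3)[of j] \<open>x < j\<close> no by auto
        qed
      qed
      moreover have "j \<in> insert x (set A - {m}) \<and> (\<exists>y\<in>insert m (set B). j < y \<and> y \<le> k)"
        if "(j, k) \<in> noninv (x # w)" for j k
      proof (cases "(j, k) \<in> noninv w")
        case True
        then show ?thesis using IH(2,3)[OF True] AB no[of j k] by (auto simp: B_def)
      next
        case False
        then have "j = x" "k \<in> set w" "x < k" using that by auto
        then show ?thesis using m AB by auto
      qed
      ultimately show ?thesis using c0 by (auto simp: T_def)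
    qed
  qed
qed


section \<open>The words of two-column tableaux\<close>

text \<open>\<open>canonical w A B\<close> describes \<open>w\<close> as the word of the tableau
  with columns \<open>A\<close> and \<open>B\<close>, built block by block from the right. A single
  letter is a maximum at the bottom of the first column. In a pair \<open>a # b\<close>, the maximum
  \<open>b\<close> is at the bottom of the second column and \<open>a\<close> at the bottom of the
  first.\<close>

inductive canonical :: "nat list \<Rightarrow> nat list \<Rightarrow> nat list \<Rightarrow> bool" where
  empty: "canonical [] [] []"
| single: "canonical v A B \<Longrightarrow> \<forall>x\<in>set v. x < s \<Longrightarrow> canonical (s # v) (A @ [s]) B"
| pair: "canonical v A B \<Longrightarrow> \<forall>x\<in>set A. x < a \<Longrightarrow> \<forall>x\<in>set v. x < b \<Longrightarrow> a < b \<Longrightarrow> a \<notin> set v \<Longrightarrow>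
    canonical (a # b # v) (A @ [a]) (B @ [b])"

lemma canonical_basic:
  assumes "canonical w A B"
  shows "distinct w" "set w = set A \<union> set B" "length w = length A + length B"
    "A = [] \<Longrightarrow> w = [] \<and> B = []"
  using assms by (induction rule: canonical.induct) force+

lemma canonical_hd_max: "canonical (u # v) A B \<Longrightarrow> x \<in> set A \<Longrightarrow> x \<le> u"
  by (cases rule: canonical.cases) (fastforce dest: canonical_basic(2))+

text \<open>A single letter goes to the bottom of the first column. In a pair, \<open>b\<close> goes
  there first and is then bumped by \<open>a\<close> to the bottom of the second column.\<close>

lemma canonical_tableau: "canonical w A B \<Longrightarrow> tableau_of_word w = two_columns A B"
proof (induction rule: canonical.induct)
  case empty
  then show ?case by (simp add: two_columns_def)
next
  case (single v A B s)
  have "\<forall>x\<in>set A. x < s" using single.hyps canonical_basic(2)[OF single.hyps(1)] by blast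
  then have "bump s A = None" by (auto simp: bump_None_iff)
  then show ?case using single canonical_basic(4)[of v A B]
    by (cases "A = []") (auto simp: two_columns_def insert_col_Cons settle_def)
next
  case (pair v A B a b)
  have lt: "\<forall>x\<in>set A \<union> set B. x < b"
    using pair.hyps canonical_basic(2)[OF pair.hyps(1)] by blast
  then have 1: "bump b A = None" by (simp add: bump_None_iff less_imp_le)
  have 2: "bump a (A @ [b]) = Some b" using pair by (auto simp: bump_Some_iff)
  have 3: "bump b B = None" using lt by (simp add: bump_None_iff less_imp_le)
  have "b \<notin> set A" using lt by auto
  then have 4: "replace b a (A @ [b]) = A @ [a]" by (auto simp: replace_def intro!: map_idI)
  \<comment> \<open>If \<open>A\<close> is empty, then so is \<open>B\<close>, and \<open>b\<close>
    opens the first column.\<close>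
  have 5: "insert_col b (two_columns A B) = (A @ [b]) # (if B = [] then [] else [B])"
    using 1 canonical_basic(4)[OF pair.hyps(1)]
    by (cases "A = []") (auto simp: two_columns_def insert_col_Cons settle_def)
  show ?case using pair.IH 2 3 4 5
    by (auto simp: two_columns_def insert_col_Cons settle_def)
qed

section \<open>Deletion reads off the blocks\<close>

lemma column_two_columns:
  assumes "A \<noteq> []"
  shows "column (two_columns A B) 0 = A" "column (two_columns A B) 1 = B"
  using assms by (auto simp: column_def two_columns_def)

lemma entries_two_columns: "entries (two_columns A B) = set A \<union> set B"
  by (auto simp: entries_def two_columns_def)

text \<open>A maximum at the bottom of the first column is expelled itself. This handles a
  single-letter block and also the second letter of a pair.\<close>

lemma deletion_word_last:
  assumes "\<forall>x\<in>set A \<union> set B. x < s"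
  shows "deletion_word (Suc i) (two_columns (A @ [s]) B) = s # deletion_word i (two_columns A B)"
proof -
  have "Max (entries (two_columns (A @ [s]) B)) = s"
    using assms by (intro Max_eqI) (auto simp: entries_two_columns intro: less_imp_le)
  moreover have "removeAll s A = A" using assms by (auto intro: removeAll_id)
  ultimately show ?thesis
    by (simp add: expelled_def deletion_def column_two_columns del: One_nat_def)
qed

text \<open>For a pair, deleting \<open>b\<close> from the second column expels \<open>a\<close>,
  and \<open>b\<close> takes its place at the bottom of the first column, from where the next
  deletion expels it.\<close>

lemma canonical_deletion_word:
  "canonical w A B \<Longrightarrow> deletion_word (length w) (two_columns A B) = w"
proof (induction rule: canonical.induct)
  case empty
  then show ?case by simp
next
  case (single v A B s)
  then show ?case using deletion_word_last[of A B s "length v"] canonical_basic(2)[of v A B] by simp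
next
  case (pair v A B a b)
  let ?T = "two_columns (A @ [a]) (B @ [b])"
  have AB: "set A \<union> set B = set v" using canonical_basic(2) pair by blast
  then have lt: "\<forall>x\<in>set A \<union> set B. x < b" using pair by auto
  have z: "Max (entries ?T) = b"
    using lt pair by (intro Max_eqI) (auto simp: entries_two_columns intro: less_imp_le)
  have "Max {x \<in> set (A @ [a]). x < b} = a"
    using pair by (intro Max_eqI) (auto intro: less_imp_le)
  moreover have "b \<notin> set (A @ [a])" using lt pair by auto
  ultimately have e: "expelled ?T b = a"
    unfolding expelled_def column_two_columns(1)[of "A @ [a]", simplified] by simp
  have "replace a b (A @ [a]) = A @ [b]" "removeAll b (B @ [b]) = B"
    using lt pair by (auto simp: replace_def intro!: map_idI removeAll_id)
  then have "deletion ?T b = two_columns (A @ [b]) B"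
    using e \<open>b \<notin> set (A @ [a])\<close> unfolding deletion_def
    by (simp add: column_two_columns del: One_nat_def)
  then have "deletion_word (Suc (Suc (length v))) ?T =
      a # deletion_word (Suc (length v)) (two_columns (A @ [b]) B)"
    using z e by (simp add: Let_def del: deletion_word.simps(2) add: deletion_word.simps(2)[of "Suc (length v)"])
  then show ?case using deletion_word_last[OF lt] pair.IH by simp
qed

lemma canonical_word: "canonical w A B \<Longrightarrow> word_of_tableau (two_columns A B) = w"
  using canonical_deletion_word[of w A B] canonical_basic(3)[of w A B]
  by (auto simp: word_of_tableau_def num_boxes_def two_columns_def)

text \<open>The largest entry is at the bottom of a column. In the first column it is split off as a
  single letter; in the second column it forms a pair with the bottom of the first.\<close>

lemma canonical_exists:
  assumes "sorted_wrt (<) A" "sorted_wrt (<) B" "set A \<inter> set B = {}" "length B \<le> length A"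
    "\<forall>i<length B. A ! i < B ! i"
  shows "\<exists>w. canonical w A B"
  using assms
proof (induction "length A + length B" arbitrary: A B rule: less_induct)
  case less
  show ?case
  proof (cases A rule: rev_cases)
    case Nil
    then show ?thesis using less.prems canonical.empty by auto
  next
    case (snoc A' a)
    show ?thesis
    proof (cases "\<forall>x\<in>set B. x < a")
      case True
      \<comment> \<open>With columns of equal length, the last row would place an entry larger than
        \<open>a\<close> in \<open>B\<close>.\<close>
      have "length B \<noteq> length A"
      proof
        assume "length B = length A"
        then have "B ! length A' \<in> set B" "A ! length A' < B ! length A'" using less.prems snoc by auto
        with True snoc show False by auto
      qed
      then have len: "length B \<le> length A'" using less.prems snoc by simp
      then have "\<forall>i<length B. A' ! i < B ! i" using less.prems(5) snoc by (auto simp: nth_append)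
      then obtain v where v: "canonical v A' B"
        using less.hyps[of A' B] less.prems len snoc by (auto simp: sorted_wrt_append)
      have "\<forall>x\<in>set v. x < a" using v canonical_basic(2)[OF v] True less.prems snoc
        by (auto simp: sorted_wrt_append)
      then show ?thesis using v canonical.single snoc by blast
    next
      case False
      then obtain x where x: "x \<in> set B" "a \<le> x" by (auto simp: not_less)
      then obtain B' b where B: "B = B' @ [b]" by (cases B rule: rev_cases) auto
      have "a < b" using x less.prems snoc B by (auto simp: sorted_wrt_append le_less)
      have "A' ! i < B' ! i" if "i < length B'" for i
      proof -
        have "i < length A'" "i < length B" using that less.prems(4) snoc B by auto
        then show ?thesis using less.prems(5) snoc B that by (auto simp: nth_append split: if_splits)
      qed
      then obtain v where v: "canonical v A' B'"
        using less.hyps[of A' B'] less.prems snoc B by (auto simp: sorted_wrt_append)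
      have "canonical (a # b # v) (A' @ [a]) (B' @ [b])"
        using v canonical_basic(2)[OF v] less.prems snoc B \<open>a < b\<close>
        by (intro canonical.pair) (auto simp: sorted_wrt_append)
      then show ?thesis using snoc B by blast
    qed
  qed
qed

lemma standard_tableaux2_canonical:
  assumes "T \<in> standard_tableaux2 n"
  obtains w A B where "canonical w A B" "T = two_columns A B" "set w = {1..n}"
proof -
  define A B where "A = column T 0" and "B = column T 1"
  have T: "[] \<notin> set T" "\<forall>k. Suc k < length T \<longrightarrow> length (T ! Suc k) \<le> length (T ! k)"
     "distinct (concat T)" "entries T = {1..n}" "\<forall>k < length T. sorted_wrt (<) (T ! k)"
     "\<forall>k i. Suc k < length T \<longrightarrow> i < length (T ! Suc k) \<longrightarrow> T ! k ! i < T ! Suc k ! i"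
     "length T \<le> 2"
    using assms by (auto simp: standard_tableaux2_def standard_tableaux_def)
  consider "T = []" | "T = [A]" "B = []" | "T = [A, B]"
    using T(7) by (cases T rule: list.exhaust; cases "tl T") (auto simp: A_def B_def column_def)
  then have TAB: "T = two_columns A B" and ex: "\<exists>w. canonical w A B"
  proof (atomize (full), cases)
    case 1
    then show "T = two_columns A B \<and> (\<exists>w. canonical w A B)"
      using canonical.empty by (auto simp: A_def B_def column_def two_columns_def)
  next
    case 2
    then show "T = two_columns A B \<and> (\<exists>w. canonical w A B)"
      using T by (auto simp: two_columns_def intro!: canonical_exists)
  next
    case 3
    have "\<exists>w. canonical w A B"
      using T(3) T(2)[rule_format, of 0] T(5)[rule_format, of 0] T(5)[rule_format, of 1]
        T(6)[rule_format, of 0] unfolding 3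
      by (intro canonical_exists) auto
    then show "T = two_columns A B \<and> (\<exists>w. canonical w A B)"
      using T(1) 3 by (auto simp: two_columns_def)
  qed
  from ex obtain w where "canonical w A B" by blast
  with TAB show thesis
    using that canonical_basic(2) T(4) entries_two_columns by metis
qed

text \<open>Single letters and second letters of pairs exceed everything after them, so
  \<open>i\<close> opens a pair, and its partner exceeds all later letters.\<close>

lemma canonical_succ:
  "canonical y A B \<Longrightarrow> y = p @ i # q \<Longrightarrow> j \<in> set q \<Longrightarrow> i < j \<Longrightarrow> \<exists>z r. q = z # r \<and> j \<le> z"
proof (induction arbitrary: p rule: canonical.induct)
  case (single v A B s)
  then show ?case by (cases p) auto
next
  case (pair v A B a b)
  then show ?case by (cases p rule: remdups_adj.cases) fastforce+
qed auto

text \<open>Letters outside \<open>A\<close> are the second letters of pairs, and the first letters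
  of pairs lie in \<open>A\<close>.\<close>

lemma canonical_pred_first_column:
  "canonical y A B \<Longrightarrow> y = p @ j # q \<Longrightarrow> j \<notin> set A \<Longrightarrow> \<exists>r x. p = r @ [x] \<and> x \<in> set A"
proof (induction arbitrary: p rule: canonical.induct)
  case (single v A B s)
  then show ?case by (cases p) fastforce+
next
  case (pair v A B a b)
  then show ?case by (cases p rule: remdups_adj.cases) fastforce+
qed auto

text \<open>The letter \<open>i\<close> must open a pair. Either \<open>j\<close> is its partner, or
  \<open>j\<close> comes later and, exceeding \<open>i\<close>, is outside the first column built so
  far; then its predecessor lies in that column, hence below \<open>i\<close>.\<close>

lemma canonical_pred:
  "canonical y A B \<Longrightarrow> y = p @ j # q \<Longrightarrow> i \<in> set p \<Longrightarrow> i < j \<Longrightarrow> \<exists>r x. p = r @ [x] \<and> x \<le> i"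
proof (induction arbitrary: p rule: canonical.induct)
  case (single v A B s)
  then obtain p' where p': "p = s # p'" "v = p' @ j # q" by (cases p) auto
  then have "i \<in> set p'" using single by auto
  then show ?case using single.IH[of p'] p' single by auto
next
  case (pair v A B a b)
  show ?case
  proof (cases p rule: remdups_adj.cases)
    case (3 x y p')
    then have p': "p = a # b # p'" "v = p' @ j # q" using pair by auto
    consider "i = a" | "i = b" | "i \<in> set p'" using p' pair by auto
    then show ?thesis
    proof cases
      case 1
      then have "j \<notin> set A" using pair by auto
      then show ?thesis using canonical_pred_first_column[OF pair.hyps(1) p'(2)] 1 pair p'
        by (auto intro: less_imp_le)
    next
      case 2
      then show ?thesis using pair p' by auto
    next
      case 3
      then show ?thesis using pair.IH[of p'] p' pair by auto
    qed
  qed (use pair in auto)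
qed auto


section \<open>Climbing along Knuth moves\<close>

text \<open>The first condition excludes consecutive 123 and 132, the second 213; the triples left
  are 231, 312 and 321.\<close>

fun stuck :: "nat list \<Rightarrow> bool" where
  "stuck (x # y # z # q) \<longleftrightarrow> \<not> (x < y \<and> x < z) \<and> \<not> (y < x \<and> x < z) \<and> stuck (y # z # q)"
| "stuck _ \<longleftrightarrow> True"

lemma not_stuck:
  "\<not> stuck w \<Longrightarrow> \<exists>p x y z q. w = p @ x # y # z # q \<and> (x < y \<and> x < z \<or> y < x \<and> x < z)"
proof (induction w rule: stuck.induct)
  case (1 x y z q)
  show ?case
  proof (cases "stuck (y # z # q)")
    case True
    then show ?thesis using 1(2) by (intro exI[of _ "[]"]) auto
  next
    case False
    then obtain p x' y' z' q' where "y # z # q = p @ x' # y' # z' # q'"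
      "x' < y' \<and> x' < z' \<or> y' < x' \<and> x' < z'"
      using 1(1) by blast
    then show ?thesis by (intro exI[of _ "x # p"]) auto
  qed
qed auto

text \<open>The first letter is put in front of the decomposition of the rest. After a descent it is
  the maximum and forms a block alone; before an ascent it joins the next letter, which was a single
  block, to a pair.\<close>

lemma stuck_canonical: "distinct w \<Longrightarrow> stuck w \<Longrightarrow> \<exists>A B. canonical w A B"
proof (induction w rule: stuck.induct)
  case (1 x y z q)
  then obtain A B where c: "canonical (y # z # q) A B" by auto
  show ?case
  proof (cases "y < x")
    case True
    have "\<forall>t\<in>set (y # z # q). t < x"
      using c
    proof (cases rule: canonical.cases)
      case (pair A' B')
      have "z < x" using True 1(2,3) by auto
      then show ?thesis using pair True by auto
    qed (use True in auto)
    then show ?thesis using canonical.single[OF c] by blast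
  next
    case False
    then have "x < y" "z < x" using 1(2,3) by auto
    from c show ?thesis
    proof (cases rule: canonical.cases)
      case (single A')
      \<comment> \<open>The head \<open>z\<close> of the remaining word bounds its first column,
        which puts \<open>x\<close> at the bottom of that column.\<close>
      have "\<forall>t\<in>set A'. t < x" using canonical_hd_max[OF single(2)] \<open>z < x\<close> by fastforce
      then show ?thesis using canonical.pair[OF single(2), of x y] single \<open>x < y\<close> 1(2) by auto
    next
      case (pair A' B')
      then show ?thesis using \<open>x < y\<close> \<open>z < x\<close> by auto
    qed
  qed
next
  case "2_1"
  then show ?case using canonical.empty by blast
next
  case ("2_2" x)
  then show ?case using canonical.single[OF canonical.empty] by auto
next
  case ("2_3" x y)
  have y: "canonical [y] [y] []" using canonical.single[OF canonical.empty] by auto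
  consider "x < y" | "y < x" using "2_3" by fastforce
  then show ?case
  proof cases
    case 1
    then show ?thesis using canonical.pair[OF canonical.empty, of x y] by auto
  next
    case 2
    then show ?thesis using canonical.single[OF y, of x] by auto
  qed
qed

text \<open>If the pair survived, \<open>y\<close> would contain \<open>a\<close>, \<open>c\<close>,
  \<open>b\<close> in this order. The predecessor of \<open>b\<close> would then be some
  \<open>x < a\<close>, which must precede \<open>a\<close> in \<open>w\<close> as well, so that
  \<open>x\<close>, \<open>a\<close>, \<open>c\<close> is a 123 in \<open>w\<close>.\<close>

lemma canonical_above_132:
  assumes y: "canonical y A B" "set y = set w" "noninv y \<subseteq> noninv w"
    and w: "w = p @ a # c # b # q" "distinct w" "avoids123 w" and abc: "a < b" "b < c"
  shows "(a, c) \<notin> noninv y"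
proof
  assume ac: "(a, c) \<in> noninv y"
  have dy: "distinct y" using canonical_basic(1)[OF y(1)] .
  have "(b, c) \<notin> noninv w"
    using w noninv_antisym[of "p @ [a]" c "b # q" b] by simp
  then have bc: "(b, c) \<notin> noninv y" using y by blast
  obtain y1 y2 where s: "y = y1 @ b # y2"
    using y(2) w(1) split_list[of b y] by auto
  have "c \<in> set y" using y(2) w(1) by simp
  then have c: "c \<in> set y1" using bc s abc by (auto simp: noninv_append)
  then have a: "a \<in> set y1" using ac dy s noninv_subset[of y1] noninv_subset[of y2]
    by (auto simp: noninv_append)
  then obtain r x where x: "y1 = r @ [x]" "x \<le> a"
    using canonical_pred[OF y(1) s] abc by blast
  \<comment> \<open>The letter \<open>c\<close> stands between \<open>a\<close> and \<open>b\<close>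
    in \<open>y\<close>.\<close>
  have "x \<noteq> a"
  proof
    assume "x = a"
    then have "c \<in> set r" using c x abc by auto
    then show False using ac \<open>x = a\<close> x s dy noninv_subset[of r] noninv_subset[of y2]
      by (auto simp: noninv_append)
  qed
  then have "x < a" using x by simp
  have "(x, b) \<in> noninv w" using x s abc y(3) by (auto simp: noninv_append)
  then have "x \<in> set p" using w noninv_subset[of p] noninv_subset[of q] \<open>x < a\<close> abc
    by (auto simp: noninv_append)
  then have "(x, a) \<in> noninv w" "(a, c) \<in> noninv w" using w(1) \<open>x < a\<close> abc
    by (auto simp: noninv_append)
  then show False using w(3) by (auto simp: avoids123_def)
qed

text \<open>If the pair survived, \<open>y\<close> would contain \<open>b\<close>, \<open>a\<close>,
  \<open>c\<close> in this order. The successor of \<open>b\<close> would then be some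
  \<open>z > c\<close>, which must follow \<open>c\<close> in \<open>w\<close> as well, so that
  \<open>b\<close>, \<open>c\<close>, \<open>z\<close> is a 123 in \<open>w\<close>.\<close>

lemma canonical_above_213:
  assumes y: "canonical y A B" "set y = set w" "noninv y \<subseteq> noninv w"
    and w: "w = p @ b # a # c # q" "distinct w" "avoids123 w" and abc: "a < b" "b < c"
  shows "(a, c) \<notin> noninv y"
proof
  assume ac: "(a, c) \<in> noninv y"
  have dy: "distinct y" using canonical_basic(1)[OF y(1)] .
  have "(a, b) \<notin> noninv w"
    using w noninv_antisym[of p b "a # c # q" a] by simp
  then have ab: "(a, b) \<notin> noninv y" using y by blast
  obtain y1 y2 where s: "y = y1 @ b # y2"
    using y(2) w(1) split_list[of b y] by auto
  have "a \<in> set y" using y(2) w(1) by simp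
  then have a: "a \<in> set y2" using ab s abc by (auto simp: noninv_append)
  then have c: "c \<in> set y2" using ac dy s noninv_subset[of y1] noninv_subset[of y2]
    by (auto simp: noninv_append)
  then obtain z r where z: "y2 = z # r" "c \<le> z"
    using canonical_succ[OF y(1) s] abc by blast
  have "z \<noteq> c"
  proof
    assume "z = c"
    then have "a \<in> set r" using a z abc by auto
    then show False using ac \<open>z = c\<close> z s dy noninv_subset[of r] noninv_subset[of y1]
      by (auto simp: noninv_append)
  qed
  then have "c < z" using z by simp
  have "(b, z) \<in> noninv w" using z s abc y(3) by (auto simp: noninv_append)
  then have "z \<in> set q" using w noninv_subset[of p] noninv_subset[of q] \<open>c < z\<close> abc
    by (auto simp: noninv_append)
  then have "(b, c) \<in> noninv w" "(c, z) \<in> noninv w" using w(1) \<open>c < z\<close> abc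
    by (auto simp: noninv_append)
  then show False using w(3) by (auto simp: avoids123_def)
qed

text \<open>The last conjunct makes \<open>v\<close> the least canonical word above
  \<open>w\<close>. It survives the induction because each Knuth move removes a pair that no
  canonical word above \<open>w\<close> has.\<close>

lemma climb:
  assumes "distinct w" "avoids123 w"
  shows "\<exists>v A B. canonical v A B \<and> set v = set w \<and> tableau_of_word v = tableau_of_word w \<and>
    noninv v \<subseteq> noninv w \<and>
    (\<forall>y A' B'. canonical y A' B' \<longrightarrow> set y = set w \<longrightarrow> noninv y \<subseteq> noninv w \<longrightarrow> noninv y \<subseteq> noninv v)"
  using assms
proof (induction "card (noninv w)" arbitrary: w rule: less_induct)
  case less
  show ?case
  proof (cases "stuck w")
    case True
    then show ?thesis using stuck_canonical[OF less.prems(1)] by blast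
  next
    case False
    then obtain p x y z q where w: "w = p @ x # y # z # q"
      and xyz: "x < y \<and> x < z \<or> y < x \<and> x < z"
      using not_stuck by blast
    \<comment> \<open>The part common to both moves: \<open>w'\<close> is the word after the move
      and \<open>(a, c)\<close> the pair that it loses.\<close>
    have step: ?thesis
      if w': "distinct w'" "set w' = set w" "tableau_of_word w' = tableau_of_word w"
        "noninv w = insert (a, c) (noninv w')" "(a, c) \<notin> noninv w'"
        "\<And>y A' B'. canonical y A' B' \<Longrightarrow> set y = set w \<Longrightarrow> noninv y \<subseteq> noninv w \<Longrightarrow> (a, c) \<notin> noninv y"
      for w' a c
    proof -
      have "card (noninv w') < card (noninv w)" using w' finite_noninv[of w'] by simp
      moreover have "avoids123 w'" using less.prems avoids123_mono[of w w'] w' by blast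
      ultimately obtain v A B where v: "canonical v A B" "set v = set w'"
         "tableau_of_word v = tableau_of_word w'" "noninv v \<subseteq> noninv w'"
         "\<forall>y A' B'. canonical y A' B' \<longrightarrow> set y = set w' \<longrightarrow> noninv y \<subseteq> noninv w' \<longrightarrow> noninv y \<subseteq> noninv v"
        using less.hyps[of w'] w'(1) by blast
      have "noninv y \<subseteq> noninv v"
        if "canonical y A' B'" "set y = set w" "noninv y \<subseteq> noninv w" for y A' B'
      proof -
        have "noninv y \<subseteq> noninv w'" using that(3) w'(4) w'(6)[OF that] by (simp add: subset_insert)
        then show ?thesis using v(5)[rule_format, OF that(1)] that(2) w'(2) by simp
      qed
      then show ?thesis using v w' by (intro exI[of _ v] exI[of _ A] exI[of _ B]) auto
    qed
    show ?thesis
    proof (cases "x < y")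
      case True
      have "\<not> y < z"
      proof
        assume "y < z"
        with True have "(x, y) \<in> noninv w" "(y, z) \<in> noninv w" by (simp_all add: w noninv_append)
        with less.prems(2) show False by (auto simp: avoids123_def)
      qed
      \<comment> \<open>The triple is a 132, and its first two letters are swapped.\<close>
      then have o: "x < z" "z < y" using xyz True less.prems(1) w by auto
      show ?thesis
      proof (rule step[of "p @ y # x # z # q" x y])
        show "tableau_of_word (p @ y # x # z # q) = tableau_of_word w"
          using knuth_tableau_of_word(1)[OF o] w less.prems by simp
        show "noninv w = insert (x, y) (noninv (p @ y # x # z # q))"
          using w noninv_swap True by blast
        show "(x, y) \<notin> noninv (p @ y # x # z # q)"
          by (rule noninv_antisym) (use less.prems w in auto)
      qed (use canonical_above_132[OF _ _ _ w less.prems o] less.prems w in auto)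
    next
      case False
      \<comment> \<open>The triple is a 213, and its last two letters are swapped.\<close>
      then have o: "y < x" "x < z" using xyz by auto
      show ?thesis
      proof (rule step[of "p @ x # z # y # q" y z])
        show "tableau_of_word (p @ x # z # y # q) = tableau_of_word w"
          using knuth_tableau_of_word(2)[OF o] w less.prems by simp
        show "noninv w = insert (y, z) (noninv (p @ x # z # y # q))"
          using w noninv_swap[of y z "p @ [x]"] o by simp
        show "(y, z) \<notin> noninv (p @ x # z # y # q)"
          using noninv_antisym[of "p @ [x]" z "y # q" y] less.prems w by auto
      qed (use canonical_above_213[OF _ _ _ w less.prems o] less.prems w in auto)
    qed
  qed
qed

text \<open>Climbing from \<open>y\<close> reaches the word of \<open>Q\<close>, a canonical word
  above \<open>w\<close>; the least such word, reached by climbing from \<open>w\<close>, is the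
  word of \<open>P\<close>. The bound on \<open>Q\<close> allows steps to be chained.\<close>

lemma duflo_step_weak_le:
  assumes "duflo_step n P Q" "length P \<le> 2"
  shows "length Q \<le> 2 \<and> weak_le n (word_of_tableau P) (word_of_tableau Q)"
proof -
  obtain w y where wy: "w \<in> cell n P" "y \<in> cell n Q" "weak_le n w y"
    using assms by (auto simp: duflo_step_def)
  then have P: "tableau_of_word w = P" and Q: "tableau_of_word y = Q"
    and le: "distinct w" "distinct y" "set w = {1..n}" "set y = {1..n}" "noninv y \<subseteq> noninv w"
    by (auto simp: cell_def weak_le_iff)
  have av: "avoids123 w" "avoids123 y"
    using two_columns_invariant[OF le(1)] P assms avoids123_mono[OF _ le(5)] by auto
  obtain y' A' B' where y': "canonical y' A' B'" "set y' = set y" "tableau_of_word y' = Q"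
    "noninv y' \<subseteq> noninv y"
    using climb[OF le(2) av(2)] Q by auto
  then obtain w' A B where w': "canonical w' A B" "set w' = set w" "tableau_of_word w' = P"
    "noninv y' \<subseteq> noninv w'"
    using climb[OF le(1) av(1)] P le by (metis order_trans)
  have "word_of_tableau P = w'" "word_of_tableau Q = y'" "length Q \<le> 2"
    using w' y' canonical_tableau canonical_word by (metis, metis, auto simp: two_columns_def)
  then show ?thesis using w' y' le canonical_basic(1) by (auto simp: weak_le_iff)
qed

theorem corollary3p12:
  fixes n :: nat and T S :: tableau
  assumes "n \<ge> 1"
    and "T \<in> standard_tableaux2 n"
    and "S \<in> standard_tableaux2 n"
  shows "duflo_less n T S \<longleftrightarrow> weak_less n (word_of_tableau T) (word_of_tableau S)"
proof -
  \<comment> \<open>Since \<open>P\<close> is recovered from its word, the map to words is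
    injective, and the words can serve as witnesses for a step.\<close>
  have cell: "word_of_tableau P \<in> cell n P" if P: "P \<in> standard_tableaux2 n" for P
  proof -
    obtain w A B where "canonical w A B" "P = two_columns A B" "set w = {1..n}"
      using standard_tableaux2_canonical[OF P] .
    then show ?thesis using canonical_tableau canonical_word canonical_basic(1)
      by (auto simp: cell_def permutations_of_set_def)
  qed
  have std: "T \<in> standard_tableaux n" "S \<in> standard_tableaux n" "length T \<le> 2"
    using assms by (auto simp: standard_tableaux2_def)
  have "weak_le n (word_of_tableau T) (word_of_tableau S)" if "(duflo_step n)\<^sup>*\<^sup>* T S"
  proof -
    \<comment> \<open>The chain may a priori pass through tableaux with more columns, so the
      induction carries the bound along.\<close>
    have "length S \<le> 2 \<and> weak_le n (word_of_tableau T) (word_of_tableau S)"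
      using that
    proof (induction rule: rtranclp_induct)
      case base
      then show ?case using cell[OF assms(2)] std
        by (auto simp: weak_le_iff cell_def permutations_of_set_def)
    next
      case (step P Q)
      then show ?case using duflo_step_weak_le[of n P Q] by (auto simp: weak_le_iff)
    qed
    then show ?thesis ..
  qed
  \<comment> \<open>A single step suffices, witnessed by the two words themselves.\<close>
  moreover have "(duflo_step n)\<^sup>*\<^sup>* T S" if "weak_le n (word_of_tableau T) (word_of_tableau S)"
    using that cell[OF assms(2)] cell[OF assms(3)] std
    by (intro r_into_rtranclp) (auto simp: duflo_step_def)
  moreover have "T \<noteq> S \<longleftrightarrow> word_of_tableau T \<noteq> word_of_tableau S"
  proof -
    have "tableau_of_word (word_of_tableau T) = T" "tableau_of_word (word_of_tableau S) = S"
      using cell[OF assms(2)] cell[OF assms(3)] by (simp_all add: cell_def)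
    then show ?thesis by metis
  qed
  ultimately show ?thesis
    using std unfolding duflo_less_def duflo_le_def weak_less_def by blast
qed

end
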